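(* Let $q = 18$, $\lambda_{18} = 2\cos(\pi/18)$, and let $G_{18} \subset \mathrm{SL}(2,\mathbb{R})$ be the Hecke triangle group generated by $S = \begin{pmatrix} 0 & -1 \\ 1 & 0 \end{pmatrix}$ and $T_{18} = \begin{pmatrix} 1 & \lambda_{18} \\ 0 & 1 \end{pmatrix}$, acting on $\mathbb{P}^1(\mathbb{R}) = \mathbb{R}\cup\{\infty\}$ by Möbius transformations. Then there are infinitely many distinct $G_{18}$-orbits of fixed points of special hyperbolic elements of $G_{18}$ contained in $\lambda_{18}\mathbb{Q}(\lambda_{18}^2)$.
   Context: A matrix $A \in \mathrm{SL}(2,\mathbb{R})$ is hyperbolic if $|\mathrm{Tr}(A)| > 2$. For $q$ even the invariant trace field of $G_q$ is $K_q = \mathbb{Q}(\lambda_q^2)$. A hyperbolic element of $G_q$ is called special if its eigenvalues lie in $K_q$. *)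

theory Defs
  imports "HOL-Analysis.Analysis"
begin

type_synonym mat2 = "real^2^2"

definition mat2 :: "real \<Rightarrow> real \<Rightarrow> real \<Rightarrow> real \<Rightarrow> mat2" where
  "mat2 a b c d = vector [vector [a, b], vector [c, d]]"

definition sl2_inv :: "mat2 \<Rightarrow> mat2" where
  "sl2_inv A = mat2 (A$2$2) (- A$1$2) (- A$2$1) (A$1$1)"

definition hecke_lambda :: "nat \<Rightarrow> real" where
  "hecke_lambda q = 2 * cos (pi / real q)"

definition hecke_S :: mat2 where "hecke_S = mat2 0 (-1) 1 0"
definition hecke_T :: "nat \<Rightarrow> mat2" where "hecke_T q = mat2 1 (hecke_lambda q) 0 1"

inductive_set hecke_group :: "nat \<Rightarrow> mat2 set" for q where
  gen_S: "hecke_S \<in> hecke_group q"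
| gen_T: "hecke_T q \<in> hecke_group q"
| mult: "A \<in> hecke_group q \<Longrightarrow> B \<in> hecke_group q \<Longrightarrow> A ** B \<in> hecke_group q"
| inv: "A \<in> hecke_group q \<Longrightarrow> sl2_inv A \<in> hecke_group q"

inductive_set field_gen :: "real \<Rightarrow> real set" for a where
  rat: "of_rat r \<in> field_gen a"
| gen: "a \<in> field_gen a"
| add: "x \<in> field_gen a \<Longrightarrow> y \<in> field_gen a \<Longrightarrow> x + y \<in> field_gen a"
| mult: "x \<in> field_gen a \<Longrightarrow> y \<in> field_gen a \<Longrightarrow> x * y \<in> field_gen a"
| uminus: "x \<in> field_gen a \<Longrightarrow> - x \<in> field_gen a"
| inverse: "x \<in> field_gen a \<Longrightarrow> inverse x \<in> field_gen a"

(* invariant trace field for q even *)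
definition trace_field :: "nat \<Rightarrow> real set" where
  "trace_field q = field_gen ((hecke_lambda q)^2)"

definition hyperbolic :: "mat2 \<Rightarrow> bool" where
  "hyperbolic A \<longleftrightarrow> \<bar>trace A\<bar> > 2"

definition is_eigenvalue :: "mat2 \<Rightarrow> real \<Rightarrow> bool" where
  "is_eigenvalue A \<mu> \<longleftrightarrow> (\<exists>v. v \<noteq> 0 \<and> A *v v = \<mu> *\<^sub>R v)"

definition special :: "nat \<Rightarrow> mat2 \<Rightarrow> bool" where
  "special q A \<longleftrightarrow> A \<in> hecke_group q \<and> hyperbolic A \<and>
     (\<forall>\<mu>. is_eigenvalue A \<mu> \<longrightarrow> \<mu> \<in> trace_field q)"

(* P^1(R) = R \<union> {\<infinity>}, encoded as real option with None = \<infinity> *)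
type_synonym proj_line = "real option"

fun mobius :: "mat2 \<Rightarrow> proj_line \<Rightarrow> proj_line" where
  "mobius A (Some x) =
     (if A$2$1 * x + A$2$2 = 0 then None
      else Some ((A$1$1 * x + A$1$2) / (A$2$1 * x + A$2$2)))"
| "mobius A None = (if A$2$1 = 0 then None else Some (A$1$1 / A$2$1))"

definition orbit :: "nat \<Rightarrow> proj_line \<Rightarrow> proj_line set" where
  "orbit q z = (\<lambda>A. mobius A z) ` hecke_group q"

definition special_fixed_point :: "nat \<Rightarrow> proj_line \<Rightarrow> bool" where
  "special_fixed_point q z \<longleftrightarrow> (\<exists>A. special q A \<and> mobius A z = z)"

end

theory Submission
  imports Defs
begin

text \<open>
  Put \<open>l = hecke_lambda q\<close>, \<open>P = T^2\<close>, and let \<open>Y\<close> be conjugate to the commutator of \<open>P\<close> and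
  \<open>S P S^-1\<close>; its trace is \<open>2 + 16 l^4\<close>, so its eigenvalues lie in the trace field as soon as
  \<open>4 l^4 + 1\<close> is a square there. For \<open>q = 18\<close> this happens: \<open>4 l^4 + 1 = (2 l^4 - 6 l^2 + 1)^2\<close>.
  There are \<open>X\<close> and \<open>Z\<close> in the group such that, in an eigenbasis of \<open>Y\<close>, the diagonal contributions
  to the trace of \<open>A m = X Y^m Z Y^-m\<close> cancel and the two remaining terms are inverse to each other;
  hence every \<open>A m\<close> is special. The Hecke group is discrete, because its nonzero entries have absolute
  value at least 1. Since the axes of the \<open>A m\<close> converge to a nondegenerate limit, infinitely many
  equivalent ones would yield infinitely many group elements in a bounded set.
\<close>

section \<open>Real 2 by 2 matrices in coordinates\<close>

lemma mat2_nth [simp]: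
  "mat2 a b c d $ 1 $ 1 = a" "mat2 a b c d $ 1 $ 2 = b"
  "mat2 a b c d $ 2 $ 1 = c" "mat2 a b c d $ 2 $ 2 = d"
  by (simp_all add: mat2_def)

lemma mat2_eta: "mat2 (A$1$1) (A$1$2) (A$2$1) (A$2$2) = A"
  by (simp add: vec_eq_iff forall_2)

lemma mat2_cases: obtains a b c d where "A = mat2 a b c d"
  using mat2_eta by metis

lemma mat2_eq_iff [simp]:
  "mat2 a b c d = mat2 a' b' c' d' \<longleftrightarrow> a = a' \<and> b = b' \<and> c = c' \<and> d = d'"
  by (metis mat2_nth)

lemma mat2_mult [simp]:
  "mat2 a b c d ** mat2 e f g h = mat2 (a*e+b*g) (a*f+b*h) (c*e+d*g) (c*f+d*h)"
  by (simp add: vec_eq_iff forall_2 matrix_matrix_mult_def sum_2)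

lemma mat2_uminus [simp]: "- mat2 a b c d = mat2 (-a) (-b) (-c) (-d)"
  by (simp add: vec_eq_iff forall_2)

lemma mat_1_mat2: "mat 1 = mat2 1 0 0 1"
  by (simp add: vec_eq_iff forall_2 mat_def)

lemma det_mat2 [simp]: "det (mat2 a b c d) = a * d - b * c"
  by (simp add: det_2)

lemma trace_mat2 [simp]: "trace (mat2 a b c d) = a + d"
  by (simp add: trace_def sum_2)

lemma sl2_inv_mat2 [simp]: "sl2_inv (mat2 a b c d) = mat2 d (-b) (-c) a"
  by (simp add: sl2_inv_def)

lemma sl2_inv_mult: "sl2_inv (A ** B) = sl2_inv B ** sl2_inv A"
  by (cases A rule: mat2_cases, cases B rule: mat2_cases) (simp add: algebra_simps)

lemma sl2_inv_sl2_inv [simp]: "sl2_inv (sl2_inv A) = A"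
  by (cases A rule: mat2_cases) simp

lemma det_sl2_inv [simp]: "det (sl2_inv A) = det A"
  by (cases A rule: mat2_cases) (simp add: algebra_simps)

lemma sl2_inv_left: "det A = 1 \<Longrightarrow> sl2_inv A ** A = mat 1"
  by (cases A rule: mat2_cases) (simp add: mat_1_mat2 algebra_simps)

lemma sl2_inv_right: "det A = 1 \<Longrightarrow> A ** sl2_inv A = mat 1"
  by (cases A rule: mat2_cases) (simp add: mat_1_mat2 algebra_simps)

lemma mult_uminus_mat2: "A ** (- B) = - (A ** B)" for A B :: mat2
  by (cases A rule: mat2_cases, cases B rule: mat2_cases) (simp add: algebra_simps)

lemma det_hecke_group: "A \<in> hecke_group q \<Longrightarrow> det A = 1"
  by (induction rule: hecke_group.induct)
    (simp_all add: hecke_S_def hecke_T_def det_mul)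

lemma hecke_group_one: "mat 1 \<in> hecke_group q"
  using hecke_group.mult[OF hecke_group.gen_S hecke_group.inv[OF hecke_group.gen_S]]
  by (simp add: sl2_inv_right det_hecke_group[OF hecke_group.gen_S])

section \<open>Discreteness of the Hecke groups\<close>

text \<open>For \<open>q \<ge> 2\<close> and \<open>i \<ge> 1\<close> this is the Chebyshev
  polynomial of the second kind of degree \<open>i - 1\<close> at \<open>cos (pi / q)\<close>. These
  values are, up to sign, the entries of the powers of \<open>T S\<close>.\<close>

definition sin_ratio :: "nat \<Rightarrow> nat \<Rightarrow> real" where
  "sin_ratio q i = sin (real i * pi / real q) / sin (pi / real q)"

lemma sin_pi_div_pos: "q \<ge> 2 \<Longrightarrow> sin (pi / real q) > 0"
  by (intro sin_gt_zero) (auto simp: field_simps)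

lemma sin_ratio_rec: "q \<ge> 2 \<Longrightarrow> sin_ratio q (i + 2) = hecke_lambda q * sin_ratio q (i + 1) - sin_ratio q i"
proof -
  assume "q \<ge> 2"
  define a where "a = pi / real q"
  define b where "b = real (i + 1) * pi / real q"
  have "real (i + 2) * pi / real q = b + a" "real i * pi / real q = b - a"
    using \<open>q \<ge> 2\<close> by (simp_all add: a_def b_def field_simps)
  then have "sin_ratio q (i + 2) = sin (b + a) / sin a" "sin_ratio q (i + 1) = sin b / sin a"
    "sin_ratio q i = sin (b - a) / sin a" "hecke_lambda q = 2 * cos a"
    by (simp_all only: sin_ratio_def hecke_lambda_def a_def b_def)
  then show ?thesis
    by (simp add: sin_add sin_diff diff_divide_distrib add_divide_distrib)
qed

lemma sin_ratio_0 [simp]: "sin_ratio q 0 = 0"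
  by (simp add: sin_ratio_def)

lemma sin_ratio_1 [simp]: "q \<ge> 2 \<Longrightarrow> sin_ratio q (Suc 0) = 1"
  using sin_pi_div_pos[of q] by (simp add: sin_ratio_def)

lemma sin_ratio_self [simp]: "sin_ratio q q = 0"
  by (cases "q = 0") (simp_all add: sin_ratio_def)

lemma sin_ratio_reflect: "i \<le> q \<Longrightarrow> q > 0 \<Longrightarrow> sin_ratio q (q - i) = sin_ratio q i"
proof -
  assume "i \<le> q" "q > 0"
  then have "real (q - i) * pi / real q = pi - real i * pi / real q"
    by (simp add: of_nat_diff field_simps)
  then show ?thesis
    by (simp add: sin_ratio_def)
qed

text \<open>The reflection \<open>i \<mapsto> q - i\<close> reduces to \<open>2 * i \<le> q\<close>,
  where the angle stays below \<open>pi / 2\<close> and the sine is increasing.\<close>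

lemma sin_ratio_ge_1: assumes "1 \<le> i" "i < q" shows "sin_ratio q i \<ge> 1"
proof -
  have q: "q \<ge> 2" using assms by simp
  have *: "sin_ratio q j \<ge> 1" if "1 \<le> j" "2 * j \<le> q" for j
  proof -
    have "pi / real q \<le> real j * pi / real q"
      using that q by (intro divide_right_mono) (auto simp: mult_le_cancel_right1)
    moreover have "real j * pi / real q \<le> pi / 2"
      using that q by (simp add: field_simps flip: of_nat_mult)
    moreover have "- (pi / 2) \<le> pi / real q"
      by (rule order_trans[of _ 0]) simp_all
    ultimately have "sin (pi / real q) \<le> sin (real j * pi / real q)"
      by (intro sin_monotone_2pi_le) auto
    then show ?thesis
      using sin_pi_div_pos[OF q] by (simp add: sin_ratio_def field_simps)
  qed
  show ?thesis
  proof (cases "2 * i \<le> q")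
    case True
    with * assms show ?thesis by blast
  next
    case False
    then have "sin_ratio q (q - i) \<ge> 1" using assms by (intro *) auto
    then show ?thesis using assms by (simp add: sin_ratio_reflect)
  qed
qed

lemma sin_ratio_Suc_self: "q \<ge> 2 \<Longrightarrow> sin_ratio q (Suc q) = - 1"
proof -
  assume q: "q \<ge> 2"
  then have "real (Suc q) * pi / real q = pi / real q + pi"
    by (simp add: field_simps)
  then show ?thesis
    using sin_pi_div_pos[OF q] by (simp add: sin_ratio_def)
qed

text \<open>Up to sign this is \<open>U^(j+1) S\<close> with \<open>U = T S\<close> of order \<open>q\<close> modulo \<open>\<plusminus>1\<close>.
  Its entries are nonnegative precisely for \<open>j + 2 \<le> q\<close>.\<close>
definition block :: "nat \<Rightarrow> nat \<Rightarrow> mat2" where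
  "block q j = mat2 (sin_ratio q (j + 1)) (sin_ratio q (j + 2)) (sin_ratio q j) (sin_ratio q (j + 1))"

text \<open>Reduced words in \<open>S\<close> and powers of \<open>U\<close>, with each
  \<open>S\<close> absorbed into the power before it. A word ending in a bare power of
  \<open>U\<close> needs the tail \<open>S\<close>, since \<open>U^(j+1)\<close> is up to sign
  \<open>block q j ** hecke_S\<close>.\<close>

inductive_set block_words :: "nat \<Rightarrow> mat2 set" for q where
  one: "mat 1 \<in> block_words q"
| S: "hecke_S \<in> block_words q"
| block: "m \<in> block_words q \<Longrightarrow> j + 2 \<le> q \<Longrightarrow> block q j ** m \<in> block_words q"

definition normal_forms :: "nat \<Rightarrow> mat2 set" where
  "normal_forms q = {g. \<exists>m \<in> block_words q.
     g = m \<or> g = - m \<or> g = hecke_S ** m \<or> g = - (hecke_S ** m)}"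

lemma normal_forms_uminus: "g \<in> normal_forms q \<Longrightarrow> - g \<in> normal_forms q"
  by (auto simp: normal_forms_def)

lemma hecke_S_S: "hecke_S ** (hecke_S ** m) = - m" for m :: mat2
  by (cases m rule: mat2_cases) (simp add: hecke_S_def)

lemma normal_forms_S: "g \<in> normal_forms q \<Longrightarrow> hecke_S ** g \<in> normal_forms q"
  by (auto simp: normal_forms_def mult_uminus_mat2 hecke_S_S)

lemma block_first: "q \<ge> 2 \<Longrightarrow> block q 0 = hecke_T q"
  using sin_ratio_rec[of q 0] by (simp add: block_def hecke_T_def numeral_2_eq_2)

lemma block_last: "q \<ge> 2 \<Longrightarrow> block q (q - 2) = mat2 1 0 (hecke_lambda q) 1"
proof -
  assume q: "q \<ge> 2"
  then have "sin_ratio q (q - 1) = 1" by (simp add: sin_ratio_reflect)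
  moreover have "sin_ratio q (q - 2) = hecke_lambda q"
    using sin_ratio_rec[of q 0] q by (simp add: sin_ratio_reflect numeral_2_eq_2)
  moreover have "Suc (q - 2) = q - 1" "Suc (Suc (q - 2)) = q" using q by auto
  ultimately show ?thesis by (simp add: block_def)
qed

text \<open>Since \<open>block q j\<close> is \<open>- U^(j+1) S\<close>, left multiplication by
  \<open>U = T S\<close> raises the exponent by one.\<close>

lemma T_S_block: "q \<ge> 2 \<Longrightarrow> hecke_T q ** (hecke_S ** block q j) = block q (Suc j)"
  using sin_ratio_rec[of q j] sin_ratio_rec[of q "Suc j"]
  by (simp add: block_def hecke_T_def hecke_S_def algebra_simps)

text \<open>The relation \<open>U^q = - 1\<close>: at exponent \<open>q\<close> only
  \<open>S\<close> remains.\<close>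

lemma block_overflow: "q \<ge> 2 \<Longrightarrow> block q (q - 1) = hecke_S"
  using sin_ratio_Suc_self[of q] by (simp add: block_def hecke_S_def sin_ratio_reflect)

text \<open>\<open>T\<close> is itself the block with \<open>j = 0\<close>, so only
  \<open>T S m\<close> needs an argument: the leading block of \<open>m\<close> absorbs
  \<open>T S\<close>, and if its exponent reaches \<open>q\<close> it collapses to
  \<open>S\<close>.\<close>

lemma normal_forms_T:
  assumes q: "q \<ge> 2" and g: "g \<in> normal_forms q"
  shows "hecke_T q ** g \<in> normal_forms q"
proof -
  have T: "hecke_T q ** m \<in> normal_forms q" if "m \<in> block_words q" for m
    using block_words.block[OF that, of 0] q by (auto simp: normal_forms_def block_first)
  have TS: "hecke_T q ** (hecke_S ** m) \<in> normal_forms q" if "m \<in> block_words q" for m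
    using that
  proof cases
    case one
    then show ?thesis using T[OF block_words.S] by simp
  next
    case S
    then have "hecke_T q ** (hecke_S ** m) = - (hecke_T q ** mat 1)"
      using hecke_S_S[of "mat 1"] by (simp add: mult_uminus_mat2)
    then show ?thesis using T[OF block_words.one] normal_forms_uminus by metis
  next
    case (block m' j)
    have eq: "hecke_T q ** (hecke_S ** m) = block q (Suc j) ** m'"
      using T_S_block[OF q, of j] block(1) by (simp add: matrix_mul_assoc)
    show ?thesis
    proof (cases "Suc j + 2 \<le> q")
      case True
      then show ?thesis
        unfolding eq using block_words.block[OF block(2) True] by (auto simp: normal_forms_def)
    next
      case False
      then have "Suc j = q - 1" using block(3) by simp
      then show ?thesis
        unfolding eq using block(2) block_overflow[OF q] by (auto simp: normal_forms_def)
    qed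
  qed
  obtain m where m: "m \<in> block_words q"
    and "g = m \<or> g = - m \<or> g = hecke_S ** m \<or> g = - (hecke_S ** m)"
    using g by (auto simp: normal_forms_def)
  then show ?thesis
    using T[OF m] TS[OF m] normal_forms_uminus by (auto simp: mult_uminus_mat2)
qed

text \<open>The last block times \<open>S\<close> is \<open>- U^-1\<close>, so it lowers the
  exponent of the next block by one.\<close>

lemma last_S_block:
  assumes q: "q \<ge> 2"
  shows "block q (q - 2) ** (hecke_S ** block q (Suc j)) = - block q j"
proof -
  have rec: "sin_ratio q (Suc (Suc j)) = hecke_lambda q * sin_ratio q (Suc j) - sin_ratio q j"
    "sin_ratio q (Suc (Suc (Suc j))) =
      hecke_lambda q * sin_ratio q (Suc (Suc j)) - sin_ratio q (Suc j)"
    using sin_ratio_rec[OF q, of j] sin_ratio_rec[OF q, of "Suc j"] by simp_all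
  have "mat2 1 0 (hecke_lambda q) 1 ** (hecke_S ** block q (Suc j)) = - block q j"
    unfolding block_def hecke_S_def mat2_mult mat2_uminus mat2_eq_iff
    by (simp add: rec algebra_simps)
  then show ?thesis by (simp only: block_last[OF q])
qed

lemma last_S_block_0: "q \<ge> 2 \<Longrightarrow> block q (q - 2) ** (hecke_S ** block q 0) = hecke_S"
  by (simp add: block_last block_first hecke_T_def hecke_S_def)

text \<open>This serves for \<open>T^-1\<close>, which equals \<open>- (S L S)\<close> with
  \<open>L\<close> the last block. It mirrors \<open>normal_forms_T\<close>: exponents fall instead
  of rising, and exponent 0 leaves a bare \<open>S\<close>.\<close>

lemma normal_forms_last:
  assumes q: "q \<ge> 2" and g: "g \<in> normal_forms q"
  shows "block q (q - 2) ** g \<in> normal_forms q"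
proof -
  let ?L = "block q (q - 2)"
  have L: "?L ** m \<in> normal_forms q" if "m \<in> block_words q" for m
    using block_words.block[OF that, of "q - 2"] q by (auto simp: normal_forms_def)
  have LS: "?L ** (hecke_S ** m) \<in> normal_forms q" if "m \<in> block_words q" for m
    using that
  proof cases
    case one
    then show ?thesis using L[OF block_words.S] by simp
  next
    case S
    then have "?L ** (hecke_S ** m) = - (?L ** mat 1)"
      using hecke_S_S[of "mat 1"] by (simp add: mult_uminus_mat2)
    then show ?thesis using L[OF block_words.one] normal_forms_uminus by metis
  next
    case (block m' j)
    show ?thesis
    proof (cases j)
      case 0
      have "?L ** (hecke_S ** m) = hecke_S ** m'"
        using last_S_block_0[OF q] block(1) 0 by (simp add: matrix_mul_assoc)
      then show ?thesis using block(2) by (auto simp: normal_forms_def)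
    next
      case (Suc i)
      have "?L ** (hecke_S ** m) = (- block q i) ** m'"
        using last_S_block[OF q, of i] block(1) Suc by (simp add: matrix_mul_assoc)
      also have "\<dots> = - (block q i ** m')"
        by (cases m' rule: mat2_cases) (simp add: block_def)
      finally show ?thesis
        using block_words.block[OF block(2), of i] block(3) Suc by (auto simp: normal_forms_def)
    qed
  qed
  obtain m where m: "m \<in> block_words q"
    and "g = m \<or> g = - m \<or> g = hecke_S ** m \<or> g = - (hecke_S ** m)"
    using g by (auto simp: normal_forms_def)
  then show ?thesis
    using L[OF m] LS[OF m] normal_forms_uminus by (auto simp: mult_uminus_mat2)
qed

lemma hecke_group_normal_forms:
  assumes q: "q \<ge> 2" and g: "g \<in> hecke_group q"
  shows "g \<in> normal_forms q"
proof -
  \<comment> \<open>The claim for \<open>g\<close> and for its inverse are proved together, so that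
    the rule \<open>inv\<close> merely swaps them.\<close>
  have "(\<forall>n \<in> normal_forms q. g ** n \<in> normal_forms q) \<and>
        (\<forall>n \<in> normal_forms q. sl2_inv g ** n \<in> normal_forms q)"
    using g
  proof induction
    case gen_S
    have "sl2_inv hecke_S ** n = - (hecke_S ** n)" for n :: mat2
      by (cases n rule: mat2_cases) (simp add: hecke_S_def)
    then show ?case using normal_forms_S normal_forms_uminus by auto
  next
    case gen_T
    have "sl2_inv (hecke_T q) ** n = - (hecke_S ** (block q (q - 2) ** (hecke_S ** n)))" for n :: mat2
      using q by (cases n rule: mat2_cases)
        (simp add: block_last hecke_S_def hecke_T_def algebra_simps)
    then show ?case
      using normal_forms_S normal_forms_uminus normal_forms_T[OF q] normal_forms_last[OF q] by auto
  next
    case (mult A B)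
    then show ?case by (simp add: sl2_inv_mult flip: matrix_mul_assoc)
  next
    case (inv A)
    then show ?case by simp
  qed
  moreover have "mat 1 \<in> normal_forms q"
    using block_words.one by (auto simp: normal_forms_def)
  ultimately show ?thesis by (metis matrix_mul_rid)
qed

lemma zero_or_ge_1_combine:
  fixes a b x y :: real
  assumes "a = 0 \<or> a \<ge> 1" "b = 0 \<or> b \<ge> 1" "x = 0 \<or> x \<ge> 1" "y = 0 \<or> y \<ge> 1"
  shows "a * x + b * y = 0 \<or> a * x + b * y \<ge> 1"
proof -
  have *: "c * z = 0 \<or> c * z \<ge> 1" if "c = 0 \<or> c \<ge> 1" "z = 0 \<or> z \<ge> 1" for c z :: real
    using that mult_mono[of 1 c 1 z] by auto
  show ?thesis using *[OF assms(1,3)] *[OF assms(2,4)] by auto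
qed

text \<open>Blocks have entries in the set of 0 and all reals \<ge> 1, which is closed under sums
  and products. The sign is chosen per column because the tail \<open>S\<close> has columns of
  opposite signs; left multiplication by blocks acts on each column separately.\<close>

lemma block_words_columns:
  assumes "m \<in> block_words q" and q: "q \<ge> 2"
  shows "\<exists>\<sigma> \<in> {1, -1}. \<forall>i. \<sigma> * m$i$j = 0 \<or> \<sigma> * m$i$j \<ge> 1"
  using assms(1)
proof induction
  case one
  then show ?case by (auto simp: mat_1_mat2 forall_2 intro!: bexI[of _ 1]) (metis exhaust_2 mat2_nth zero_le_one order_refl)+
next
  case S
  have "j = 1 \<or> j = 2" by (rule exhaust_2)
  then show ?case by (auto simp: hecke_S_def forall_2)
next
  case (block m k)
  then obtain \<sigma> where \<sigma>: "\<sigma> \<in> {1, -1}" "\<And>i. \<sigma> * m$i$j = 0 \<or> \<sigma> * m$i$j \<ge> 1" by blast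
  have s: "sin_ratio q i = 0 \<or> sin_ratio q i \<ge> 1" if "i \<le> q" for i
    using that sin_ratio_ge_1[of i q] by (cases "i = 0"; cases "i = q") auto
  have "\<sigma> * (block q k ** m)$i$j = 0 \<or> \<sigma> * (block q k ** m)$i$j \<ge> 1" for i
  proof -
    have "\<sigma> * (block q k ** m)$i$j = block q k $i$1 * (\<sigma> * m$1$j) + block q k $i$2 * (\<sigma> * m$2$j)"
      by (simp add: matrix_matrix_mult_def sum_2 algebra_simps)
    moreover have "block q k $i$l = 0 \<or> block q k $i$l \<ge> 1" for l
      using exhaust_2[of i] exhaust_2[of l] block(2) s[of k] s[of "k + 1"] s[of "k + 2"]
      by (auto simp: block_def)
    ultimately show ?thesis
      using zero_or_ge_1_combine \<sigma>(2) by metis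
  qed
  with \<sigma>(1) show ?case by blast
qed

lemma hecke_group_entries:
  assumes q: "q \<ge> 2" and g: "g \<in> hecke_group q"
  shows "g$i$j = 0 \<or> \<bar>g$i$j\<bar> \<ge> 1"
proof -
  obtain m where m: "m \<in> block_words q"
    and g: "g = m \<or> g = - m \<or> g = hecke_S ** m \<or> g = - (hecke_S ** m)"
    using hecke_group_normal_forms[OF assms] by (auto simp: normal_forms_def)
  have *: "m$i$j = 0 \<or> \<bar>m$i$j\<bar> \<ge> 1" for i
    using block_words_columns[OF m q, of j] by force
  have "(hecke_S ** m)$1$j = - m$2$j" "(hecke_S ** m)$2$j = m$1$j"
    by (simp_all add: hecke_S_def matrix_matrix_mult_def sum_2)
  then have "(hecke_S ** m)$i$j = 0 \<or> \<bar>(hecke_S ** m)$i$j\<bar> \<ge> 1"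
    using exhaust_2[of i] * by (metis abs_minus_cancel neg_equal_0_iff_equal)
  then show ?thesis using g *[of i] by auto
qed

section \<open>Finiteness of bounded parts of the group\<close>

lemma norm_mat2_le: "norm A \<le> (\<Sum>i\<in>UNIV. \<Sum>j\<in>UNIV. \<bar>A$i$j\<bar>)" for A :: mat2
proof -
  have "norm A \<le> (\<Sum>i\<in>UNIV. norm (A$i))"
    unfolding norm_vec_def by (rule L2_set_le_sum) simp
  also have "\<dots> \<le> (\<Sum>i\<in>UNIV. \<Sum>j\<in>UNIV. \<bar>A$i$j\<bar>)"
    by (intro sum_mono norm_le_l1_cart)
  finally show ?thesis .
qed

lemma finite_hecke_group_bounded:
  assumes q: "q \<ge> 2"
  shows "finite {g \<in> hecke_group q. \<forall>i j. \<bar>g$i$j\<bar> \<le> R}"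
proof (rule ccontr)
  define F where "F = {g \<in> hecke_group q. \<forall>i j. \<bar>g$i$j\<bar> \<le> R}"
  assume "infinite {g \<in> hecke_group q. \<forall>i j. \<bar>g$i$j\<bar> \<le> R}"
  then have inf: "infinite F" by (simp add: F_def)
  have "bounded F"
  proof (rule boundedI)
    fix A assume "A \<in> F"
    then have "(\<Sum>i\<in>UNIV. \<Sum>j\<in>UNIV. \<bar>A$i$j\<bar>) \<le> (\<Sum>i\<in>(UNIV::2 set). \<Sum>j\<in>(UNIV::2 set). R)"
      by (intro sum_mono) (auto simp: F_def)
    with norm_mat2_le[of A] show "norm A \<le> (\<Sum>i\<in>(UNIV::2 set). \<Sum>j\<in>(UNIV::2 set). R)" by simp
  qed
  then have "compact (closure F)" by simp
  then obtain L where "L islimpt F"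
    using Heine_Borel_imp_Bolzano_Weierstrass inf closure_subset by metis
  \<comment> \<open>Two elements in the ball differ by less than \<open>2 * e\<close> in each entry.
    An entry of \<open>g h^-1 - 1\<close> is a sum of two products of such a difference with an
    entry of \<open>h\<close>, so it is below \<open>4 * e * R < 1\<close>.\<close>
  define e where "e = 1 / (4 * (\<bar>R\<bar> + 1))"
  have "e > 0" by (simp add: e_def)
  then have inf': "infinite (F \<inter> ball L e)"
    using \<open>L islimpt F\<close> by (simp add: islimpt_eq_infinite_ball)
  then obtain g where g: "g \<in> F \<inter> ball L e"
    by (metis finite.emptyI ex_in_conv)
  have "infinite (F \<inter> ball L e - {g})" using inf' by simp
  then obtain h where h: "h \<in> F \<inter> ball L e" "h \<noteq> g"
    by (metis DiffD1 DiffD2 finite.emptyI ex_in_conv singletonI)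
  have "dist g h < 2 * e"
    using g h dist_triangle_half_r[of L g "2 * e" h] by (simp add: dist_commute)
  then have close: "\<bar>g$i$j - h$i$j\<bar> < 2 * e" for i j
    using Finite_Cartesian_Product.norm_nth_le[of "g - h" i] component_le_norm_cart[of "(g - h)$i" j]
    by (simp add: dist_norm)
  have hR: "\<bar>h$i$j\<bar> \<le> R" for i j using h by (simp add: F_def)
  have R: "R \<ge> 0" using hR[of 1 1] by linarith
  have small: "\<bar>x * a + y * b\<bar> < 1"
    if "\<bar>x\<bar> < 2 * e" "\<bar>y\<bar> < 2 * e" "\<bar>a\<bar> \<le> R" "\<bar>b\<bar> \<le> R" for x y a b
  proof -
    have "\<bar>x * a\<bar> \<le> 2 * e * R" "\<bar>y * b\<bar> \<le> 2 * e * R"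
      using that R by (auto simp: abs_mult intro!: mult_mono)
    moreover have "4 * e * R < 1"
      using R by (simp add: e_def field_simps)
    ultimately show ?thesis by linarith
  qed
  have gG: "g \<in> hecke_group q" and hG: "h \<in> hecke_group q" using g h by (auto simp: F_def)
  define k where "k = g ** sl2_inv h"
  have kG: "k \<in> hecke_group q"
    unfolding k_def using gG hG by (intro hecke_group.mult hecke_group.inv)
  obtain a b c d where gm: "g = mat2 a b c d" by (rule mat2_cases)
  obtain a' b' c' d' where hm: "h = mat2 a' b' c' d'" by (rule mat2_cases)
  note cl = close[of 1 1] close[of 1 2] close[of 2 1] close[of 2 2]
  note hb = hR[of 1 1] hR[of 1 2] hR[of 2 1] hR[of 2 2]
  have dh: "a' * d' - b' * c' = 1" using det_hecke_group[OF hG] hm by simp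
  have km: "k = mat2 (a * d' - b * c') (b * a' - a * b') (c * d' - d * c') (d * a' - c * b')"
    by (simp add: k_def gm hm)
  have "\<bar>(b - b') * a' + (a - a') * - b'\<bar> < 1" "\<bar>(c - c') * d' + (d - d') * - c'\<bar> < 1"
    "\<bar>(a - a') * d' + (b - b') * - c'\<bar> < 1" "\<bar>(d - d') * a' + (c - c') * - b'\<bar> < 1"
    by (rule small; use cl hb in \<open>simp add: gm hm\<close>)+
  moreover have "(b - b') * a' + (a - a') * - b' = k$1$2" "(c - c') * d' + (d - d') * - c' = k$2$1"
    "(a - a') * d' + (b - b') * - c' = k$1$1 - 1" "(d - d') * a' + (c - c') * - b' = k$2$2 - 1"
    unfolding dh[symmetric] km mat2_nth by (simp_all add: algebra_simps)
  ultimately have "\<bar>k$1$2\<bar> < 1" "\<bar>k$2$1\<bar> < 1" "k$1$1 > 0" "k$2$2 > 0"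
    by auto
  \<comment> \<open>The gap between 0 and 1 makes the off-diagonal entries vanish and the diagonal
    ones at least 1; determinant 1 then forces the identity.\<close>
  then have k0: "k$1$2 = 0" "k$2$1 = 0" and k1: "k$1$1 \<ge> 1" "k$2$2 \<ge> 1"
    using hecke_group_entries[OF q kG, of 1 2] hecke_group_entries[OF q kG, of 2 1]
      hecke_group_entries[OF q kG, of 1 1] hecke_group_entries[OF q kG, of 2 2] by auto
  have "k$1$1 * k$2$2 = 1" using det_hecke_group[OF kG] k0 by (simp add: det_2)
  moreover have "k$1$1 * 1 \<le> k$1$1 * k$2$2" "1 * k$2$2 \<le> k$1$1 * k$2$2"
    using k1 by (intro mult_left_mono mult_right_mono; simp)+
  ultimately have "k$1$1 = 1" "k$2$2 = 1" using k1 by linarith+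
  with k0 have "k = mat 1" using mat2_eta[of k] by (simp add: mat_1_mat2)
  then have "g ** (sl2_inv h ** h) = h" by (simp add: k_def matrix_mul_assoc)
  with h show False by (simp add: sl2_inv_left det_hecke_group[OF hG])
qed

section \<open>Orbits of hyperbolic fixed points\<close>

definition vec2 :: "real \<Rightarrow> real \<Rightarrow> real^2" where
  "vec2 x y = vector [x, y]"

lemma vec2_nth [simp]: "vec2 x y $ 1 = x" "vec2 x y $ 2 = y"
  by (simp_all add: vec2_def)

lemma vec2_eq_iff [simp]: "vec2 x y = vec2 x' y' \<longleftrightarrow> x = x' \<and> y = y'"
  by (metis vec2_nth)

lemma vec2_cases: obtains x y where "v = vec2 x y"
proof -
  have "v = vec2 (v$1) (v$2)" by (simp add: vec_eq_iff forall_2)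
  then show ?thesis by (rule that)
qed

lemma mat2_mult_vec2 [simp]: "mat2 a b c d *v vec2 x y = vec2 (a * x + b * y) (c * x + d * y)"
  by (simp add: vec_eq_iff forall_2 matrix_vector_mult_def sum_2)

lemma scaleR_vec2 [simp]: "k *\<^sub>R vec2 x y = vec2 (k * x) (k * y)"
  by (simp add: vec_eq_iff forall_2)

lemma add_vec2 [simp]: "vec2 x y + vec2 x' y' = vec2 (x + x') (y + y')"
  by (simp add: vec_eq_iff forall_2)

text \<open>Moebius maps are handled as linear maps on vectors \<open>(x, 1)\<close> up to a scalar,
  which turns fixed points into eigenvectors.\<close>

lemma mobius_SomeD:
  assumes "mobius A (Some x) = Some y"
  obtains k where "k \<noteq> 0" "A *v vec2 x 1 = k *\<^sub>R vec2 y 1"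
proof -
  obtain a b c d where A: "A = mat2 a b c d" by (rule mat2_cases)
  have "c * x + d \<noteq> 0" using assms by (auto simp: A)
  moreover from this have "A *v vec2 x 1 = (c * x + d) *\<^sub>R vec2 y 1"
    using assms by (auto simp: A)
  ultimately show thesis by (rule that)
qed

lemma mobius_SomeI:
  assumes "A *v vec2 x 1 = k *\<^sub>R vec2 y 1" "k \<noteq> 0"
  shows "mobius A (Some x) = Some y"
  using assms by (cases A rule: mat2_cases) (auto simp: field_simps)

lemma orbit_refl: "z \<in> orbit q z"
proof -
  have "mobius (mat 1) z = z" by (cases z) (simp_all add: mat_1_mat2)
  then show ?thesis unfolding orbit_def using hecke_group_one by (metis image_eqI)
qed

text \<open>If two slopes belonged to the same eigenvalue, \<open>H\<close> would be the scalar
  matrix \<open>\<rho>\<close>, of determinant \<open>\<rho>^2 \<noteq> 1\<close>. So each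
  \<open>H\<close> contributes at most one slope.\<close>

lemma finite_slopes_of_eigenvalue:
  assumes F: "finite F" and \<rho>: "\<rho>^2 \<noteq> 1" and det: "\<And>H. H \<in> F \<Longrightarrow> det H = 1"
  shows "finite {x. \<exists>H \<in> F. H *v vec2 x 1 = \<rho> *\<^sub>R vec2 x 1}"
proof -
  have "finite {x. H *v vec2 x 1 = \<rho> *\<^sub>R vec2 x 1}" if "H \<in> F" for H
  proof -
    obtain a b c d where H: "H = mat2 a b c d" by (rule mat2_cases)
    have "x = y" if "H *v vec2 x 1 = \<rho> *\<^sub>R vec2 x 1" "H *v vec2 y 1 = \<rho> *\<^sub>R vec2 y 1" for x y
    proof (rule ccontr)
      assume "x \<noteq> y"
      have 1: "a * x + b = \<rho> * x" "a * y + b = \<rho> * y" "c * x + d = \<rho>" "c * y + d = \<rho>"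
        using that by (simp_all add: H)
      then have "c * (x - y) = 0" "(a - \<rho>) * (x - y) = 0"
        unfolding left_diff_distrib right_diff_distrib by linarith+
      with \<open>x \<noteq> y\<close> 1 have "c = 0" "a = \<rho>" "d = \<rho>" by auto
      with det[OF \<open>H \<in> F\<close>] \<rho> show False by (simp add: H power2_eq_square)
    qed
    then have "{x. H *v vec2 x 1 = \<rho> *\<^sub>R vec2 x 1} \<subseteq> {SOME x. H *v vec2 x 1 = \<rho> *\<^sub>R vec2 x 1}"
      by (auto intro: someI2)
    then show ?thesis by (rule finite_subset) simp
  qed
  moreover have "{x. \<exists>H \<in> F. H *v vec2 x 1 = \<rho> *\<^sub>R vec2 x 1} =
      (\<Union>H\<in>F. {x. H *v vec2 x 1 = \<rho> *\<^sub>R vec2 x 1})" by auto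
  ultimately show ?thesis using F by simp
qed

text \<open>If \<open>g\<close> maps the fixed point of \<open>A n\<close> to that of \<open>A m\<close>, then \<open>g (A n) g^-1\<close> is upper triangular in
  the basis \<open>D m\<close>; conjugating it by a large power of \<open>A m\<close> shrinks the off-diagonal entry, so a bounded
  element of the group with the prescribed eigenvalue fixes the same point.\<close>
lemma finite_equivalent_axes:
  fixes p1 p2 q1 q2 u :: "nat \<Rightarrow> real" and A :: "nat \<Rightarrow> mat2"
  defines "D \<equiv> \<lambda>m. mat2 (p1 m) (q1 m) (p2 m) (q2 m)"
  assumes q: "q \<ge> 2"
    and A: "\<And>m. A m \<in> hecke_group q"
    and eigen: "\<And>m. A m ** D m = D m ** mat2 (u m) 0 0 (inverse (u m))"
    and u: "\<And>m. u m > 1"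
    and bound: "\<And>m i j. \<bar>D m$i$j\<bar> \<le> K"
    and \<delta>: "\<delta> > 0" "\<And>m. det (D m) \<ge> \<delta>"
    and p2: "\<And>m. p2 m \<noteq> 0"
    and inj: "inj (\<lambda>m. p1 m / p2 m)"
  shows "finite {m. Some (p1 m / p2 m) \<in> orbit q (Some (p1 n / p2 n))}"
proof -
  define x where "x = (\<lambda>m. p1 m / p2 m)"
  define \<rho> where "\<rho> = u n"
  have \<rho>: "\<rho> > 1" using u by (simp add: \<rho>_def)
  \<comment> \<open>Bounds the entries of \<open>D N' D^-1\<close>: the coefficients of
    \<open>N'\<close> are \<open>\<rho>\<close> and two of absolute value at most 1, each multiplied
    by a product of two entries of \<open>D\<close>, and the determinant is at least
    \<open>\<delta>\<close>.\<close>
  define R where "R = (\<rho> + 2) * K^2 / \<delta>"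
  define F where "F = {g \<in> hecke_group q. \<forall>i j. \<bar>g$i$j\<bar> \<le> R}"
  have col: "M *v vec2 (x m) 1 = c *\<^sub>R vec2 (x m) 1 \<longleftrightarrow> M *v vec2 (p1 m) (p2 m) = c *\<^sub>R vec2 (p1 m) (p2 m)"
    for M c m
  proof -
    have "vec2 (p1 m) (p2 m) = p2 m *\<^sub>R vec2 (x m) 1" using p2 by (simp add: x_def)
    then have "M *v vec2 (p1 m) (p2 m) = p2 m *\<^sub>R (M *v vec2 (x m) 1)"
      by (simp only: matrix_vector_mult_scaleR)
    moreover have "c *\<^sub>R vec2 (p1 m) (p2 m) = p2 m *\<^sub>R (c *\<^sub>R vec2 (x m) 1)"
      using p2 by (simp add: x_def)
    ultimately show ?thesis using p2[of m] by (metis scaleR_cancel_left)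
  qed
  have "\<exists>H \<in> F. H *v vec2 (x m) 1 = \<rho> *\<^sub>R vec2 (x m) 1"
    if m: "Some (x m) \<in> orbit q (Some (x n))" for m
  proof -
    have det0: "det (D m) > 0" using \<delta>(1) \<delta>(2)[of m] by linarith
    obtain g where g: "g \<in> hecke_group q" "mobius g (Some (x n)) = Some (x m)"
      using m by (auto simp: orbit_def)
    obtain k where k: "k \<noteq> 0" "g *v vec2 (x n) 1 = k *\<^sub>R vec2 (x m) 1"
      using mobius_SomeD[OF g(2)] .
    \<comment> \<open>The conjugate fixes \<open>x m\<close> with the eigenvalue of
      \<open>A n\<close>, a number independent of \<open>m\<close>.\<close>
    define H0 where "H0 = g ** A n ** sl2_inv g"
    have H0G: "H0 \<in> hecke_group q"
      unfolding H0_def using A g by (intro hecke_group.mult hecke_group.inv)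
    have An: "A n *v vec2 (x n) 1 = \<rho> *\<^sub>R vec2 (x n) 1"
      using arg_cong[OF eigen[of n], of "\<lambda>M. M *v vec2 1 0"]
      by (simp only: col flip: matrix_vector_mul_assoc) (simp add: D_def \<rho>_def mult.commute)
    have "H0 *v (g *v vec2 (x n) 1) = g *v (A n *v ((sl2_inv g ** g) *v vec2 (x n) 1))"
      by (simp add: H0_def matrix_vector_mul_assoc matrix_mul_assoc)
    also have "\<dots> = \<rho> *\<^sub>R (g *v vec2 (x n) 1)"
      by (simp add: sl2_inv_left det_hecke_group[OF g(1)] An matrix_vector_mult_scaleR
          del: scaleR_vec2)
    finally have "k *\<^sub>R (H0 *v vec2 (x m) 1) = k *\<^sub>R (\<rho> *\<^sub>R vec2 (x m) 1)"
      using k by (simp only: matrix_vector_mult_scaleR scaleR_left_commute)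
    with k have "H0 *v vec2 (x m) 1 = \<rho> *\<^sub>R vec2 (x m) 1"
      by (simp only: scaleR_cancel_left) simp
    then have H0p: "H0 *v vec2 (p1 m) (p2 m) = \<rho> *\<^sub>R vec2 (p1 m) (p2 m)"
      by (simp only: col)
    have invD: "invertible (D m)" using det0 by (simp add: invertible_det_nz)
    then obtain D' where D': "D m ** D' = mat 1" by (auto simp: invertible_def)
    \<comment> \<open>\<open>N\<close> is \<open>H0\<close> in the basis \<open>D m\<close>. Its
      first column is known because the first column of \<open>D m\<close> is an
      eigenvector.\<close>
    define N where "N = D' ** (H0 ** D m)"
    have DN: "H0 ** D m = D m ** N"
      by (simp add: N_def matrix_mul_assoc D')
    obtain n1 \<beta> n2 \<gamma> where N: "N = mat2 n1 \<beta> n2 \<gamma>" by (rule mat2_cases)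
    have "D m *v vec2 n1 n2 = D m *v (N *v vec2 1 0)" by (simp add: N)
    also have "\<dots> = H0 *v (D m *v vec2 1 0)" by (simp only: matrix_vector_mul_assoc DN)
    also have "\<dots> = D m *v vec2 \<rho> 0" using H0p by (simp add: D_def mult.commute)
    finally have "vec2 n1 n2 = vec2 \<rho> 0"
      using invD by (metis inj_matrix_vector_mult injD)
    then have N: "N = mat2 \<rho> \<beta> 0 \<gamma>" by (simp add: N)
    have "det (D m) * det N = det (D m)"
      using arg_cong[OF DN, of det] det_hecke_group[OF H0G] by (simp add: det_mul)
    with det0 have \<gamma>: "\<rho> * \<gamma> = 1" by (simp add: N)
    then have "\<gamma> = inverse \<rho>" by (rule inverse_unique[symmetric])
    then have \<gamma>': "\<bar>\<gamma>\<bar> \<le> 1" using \<rho> by (simp add: inverse_le_1_iff)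
    have pow: "\<exists>C \<in> hecke_group q. C ** D m = D m ** mat2 (u m ^ j) 0 0 (inverse (u m ^ j))" for j
    proof (induction j)
      case 0
      show ?case by (auto intro!: bexI[of _ "mat 1"] hecke_group_one simp flip: mat_1_mat2)
    next
      case (Suc j)
      then obtain C where C: "C \<in> hecke_group q"
        "C ** D m = D m ** mat2 (u m ^ j) 0 0 (inverse (u m ^ j))" by blast
      have "(A m ** C) ** D m = (A m ** D m) ** mat2 (u m ^ j) 0 0 (inverse (u m ^ j))"
        by (simp only: C(2) flip: matrix_mul_assoc)
      also have "\<dots> = D m ** mat2 (u m ^ Suc j) 0 0 (inverse (u m ^ Suc j))"
        by (simp add: eigen flip: matrix_mul_assoc)
      finally show ?case using hecke_group.mult[OF A C(1)] by blast
    qed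
    \<comment> \<open>Conjugation by the \<open>j\<close>-th power of \<open>A m\<close> divides
      \<open>\<beta>\<close> by \<open>w^2\<close> with \<open>w = u m ^ j\<close>, so this
      \<open>j\<close> brings it down to absolute value at most 1.\<close>
    obtain j where j: "\<bar>\<beta>\<bar> < u m ^ j" using real_arch_pow[OF u] by blast
    obtain C where C: "C \<in> hecke_group q"
        "C ** D m = D m ** mat2 (u m ^ j) 0 0 (inverse (u m ^ j))" using pow by blast
    define w where "w = u m ^ j"
    have w: "w \<ge> 1" "\<bar>\<beta>\<bar> < w" using u[of m] j by (auto simp: w_def one_le_power less_imp_le)
    define \<beta>' where "\<beta>' = \<beta> / w^2"
    have \<beta>': "\<bar>\<beta>'\<bar> \<le> 1"
    proof -
      have "\<bar>\<beta>\<bar> \<le> w^2" using w self_le_power[of w 2] by linarith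
      then show ?thesis using w by (simp add: \<beta>'_def field_simps)
    qed
    define H where "H = sl2_inv C ** (H0 ** C)"
    have HG: "H \<in> hecke_group q"
      unfolding H_def using C H0G by (intro hecke_group.mult hecke_group.inv)
    define W where "W = mat2 w 0 0 (inverse w)"
    define N' where "N' = mat2 \<rho> \<beta>' 0 \<gamma>"
    have CW: "C ** D m = D m ** W" using C(2) by (simp only: W_def w_def)
    have NW: "N ** W = W ** N'"
      using w by (simp add: N W_def N'_def \<beta>'_def field_simps power2_eq_square)
    have "H ** D m = sl2_inv C ** (H0 ** (C ** D m))" by (simp only: H_def matrix_mul_assoc)
    also have "\<dots> = sl2_inv C ** ((H0 ** D m) ** W)" by (simp only: CW matrix_mul_assoc)
    also have "\<dots> = sl2_inv C ** (D m ** (N ** W))" by (simp only: DN matrix_mul_assoc)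
    also have "\<dots> = sl2_inv C ** ((D m ** W) ** N')" by (simp only: NW matrix_mul_assoc)
    also have "\<dots> = (sl2_inv C ** C) ** (D m ** N')" by (simp only: CW[symmetric] matrix_mul_assoc)
    also have "\<dots> = D m ** N'" by (simp add: sl2_inv_left det_hecke_group[OF C(1)])
    finally have HD: "H ** D m = D m ** mat2 \<rho> \<beta>' 0 \<gamma>" by (simp only: N'_def)
    obtain a b c d where H: "H = mat2 a b c d" by (rule mat2_cases)
    define P1 P2 Q1 Q2 where "P1 = p1 m" and "P2 = p2 m" and "Q1 = q1 m" and "Q2 = q2 m"
    have K: "\<bar>P1\<bar> \<le> K" "\<bar>P2\<bar> \<le> K" "\<bar>Q1\<bar> \<le> K" "\<bar>Q2\<bar> \<le> K"
      using bound[of m 1 1] bound[of m 1 2] bound[of m 2 1] bound[of m 2 2]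
      by (simp_all add: D_def P1_def P2_def Q1_def Q2_def)
    define \<Delta> where "\<Delta> = P1 * Q2 - Q1 * P2"
    have \<Delta>: "\<Delta> \<ge> \<delta>" using \<delta>(2)[of m] by (simp add: D_def \<Delta>_def P1_def P2_def Q1_def Q2_def)
    have e: "a * P1 + b * P2 = \<rho> * P1" "c * P1 + d * P2 = \<rho> * P2"
      "a * Q1 + b * Q2 = \<beta>' * P1 + \<gamma> * Q1" "c * Q1 + d * Q2 = \<beta>' * P2 + \<gamma> * Q2"
      using HD by (simp_all add: H D_def P1_def P2_def Q1_def Q2_def algebra_simps)
    \<comment> \<open>Each entry of \<open>H\<close>, multiplied by \<open>\<Delta>\<close>, is an
      entry of \<open>D N'\<close> times the adjugate of \<open>D\<close>, hence a sum of three such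
      terms.\<close>
    have entry: "\<bar>h\<bar> \<le> R" if h: "h * \<Delta> = \<rho> * y * z + \<beta>' * y' * z' + \<gamma> * y'' * z''"
      and y: "\<bar>y\<bar> \<le> K" "\<bar>z\<bar> \<le> K" "\<bar>y'\<bar> \<le> K" "\<bar>z'\<bar> \<le> K" "\<bar>y''\<bar> \<le> K" "\<bar>z''\<bar> \<le> K"
      for h y z y' z' y'' z''
    proof -
      have K2: "\<bar>y1 * z1\<bar> \<le> K^2" if "\<bar>y1\<bar> \<le> K" "\<bar>z1\<bar> \<le> K" for y1 z1
        using that by (auto simp: abs_mult power2_eq_square intro!: mult_mono)
      have "\<bar>h\<bar> * \<delta> \<le> \<bar>h * \<Delta>\<bar>"
        using \<Delta> \<delta> by (simp add: abs_mult mult_left_mono)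
      also have "\<dots> \<le> \<bar>\<rho> * (y * z)\<bar> + \<bar>\<beta>' * (y' * z')\<bar> + \<bar>\<gamma> * (y'' * z'')\<bar>"
        using h by (simp add: mult.assoc)
      also have "\<dots> \<le> \<rho> * K^2 + 1 * K^2 + 1 * K^2"
      proof (intro add_mono)
        have *: "\<bar>x * y\<bar> \<le> x' * K^2" if "\<bar>x\<bar> \<le> x'" "\<bar>y\<bar> \<le> K^2" for x x' y
          using that unfolding abs_mult by (intro mult_mono) auto
        show "\<bar>\<rho> * (y * z)\<bar> \<le> \<rho> * K^2" using \<rho> by (intro * K2 y) simp
        show "\<bar>\<beta>' * (y' * z')\<bar> \<le> 1 * K^2" by (intro * K2 y \<beta>')
        show "\<bar>\<gamma> * (y'' * z'')\<bar> \<le> 1 * K^2" by (intro * K2 y \<gamma>')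
      qed
      finally show ?thesis using \<delta>(1) by (simp add: R_def field_simps)
    qed
    have "\<bar>a\<bar> \<le> R"
    proof (rule entry)
      show "a * \<Delta> = \<rho> * P1 * Q2 + \<beta>' * P1 * (- P2) + \<gamma> * Q1 * (- P2)"
        using e unfolding \<Delta>_def by algebra
    qed (use K in auto)
    moreover have "\<bar>b\<bar> \<le> R"
    proof (rule entry)
      show "b * \<Delta> = \<rho> * P1 * (- Q1) + \<beta>' * P1 * P1 + \<gamma> * Q1 * P1"
        using e unfolding \<Delta>_def by algebra
    qed (use K in auto)
    moreover have "\<bar>c\<bar> \<le> R"
    proof (rule entry)
      show "c * \<Delta> = \<rho> * P2 * Q2 + \<beta>' * P2 * (- P2) + \<gamma> * Q2 * (- P2)"
        using e unfolding \<Delta>_def by algebra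
    qed (use K in auto)
    moreover have "\<bar>d\<bar> \<le> R"
    proof (rule entry)
      show "d * \<Delta> = \<rho> * P2 * (- Q1) + \<beta>' * P2 * P1 + \<gamma> * Q2 * P1"
        using e unfolding \<Delta>_def by algebra
    qed (use K in auto)
    ultimately have "H \<in> F" using HG by (simp add: F_def H forall_2)
    moreover have "H *v vec2 (p1 m) (p2 m) = \<rho> *\<^sub>R vec2 (p1 m) (p2 m)"
      using e by (simp add: H P1_def P2_def)
    ultimately show ?thesis using col by blast
  qed
  \<comment> \<open>The set on the right depends on \<open>n\<close> only, through
    \<open>\<rho>\<close>, and \<open>F\<close> is finite by discreteness.\<close>
  then have "x ` {m. Some (x m) \<in> orbit q (Some (x n))} \<subseteq>
      {y. \<exists>H \<in> F. H *v vec2 y 1 = \<rho> *\<^sub>R vec2 y 1}"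
    by blast
  moreover have "finite {y. \<exists>H \<in> F. H *v vec2 y 1 = \<rho> *\<^sub>R vec2 y 1}"
  proof (rule finite_slopes_of_eigenvalue)
    show "finite F" unfolding F_def by (rule finite_hecke_group_bounded[OF q])
    show "\<rho>^2 \<noteq> 1" using \<rho> by (simp add: power2_eq_1_iff)
    show "\<And>H. H \<in> F \<Longrightarrow> det H = 1" by (auto simp: F_def det_hecke_group)
  qed
  ultimately have "finite (x ` {m. Some (x m) \<in> orbit q (Some (x n))})"
    by (rule finite_subset)
  then show ?thesis
    using inj by (auto simp: x_def intro: finite_imageD inj_on_subset)
qed

section \<open>Diagonalized matrices and the trace field\<close>

lemma is_eigenvalue_diagonalized:
  assumes AD: "A ** D = D ** mat2 u 0 0 u'" and D: "invertible D" and ev: "is_eigenvalue A \<nu>"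
  shows "\<nu> = u \<or> \<nu> = u'"
proof -
  obtain x where x: "x \<noteq> 0" "A *v x = \<nu> *\<^sub>R x"
    using ev by (auto simp: is_eigenvalue_def)
  obtain D' where D': "D ** D' = mat 1" using D by (auto simp: invertible_def)
  define y where "y = D' *v x"
  have xy: "x = D *v y"
    by (simp add: y_def matrix_vector_mul_assoc D')
  have "D *v (mat2 u 0 0 u' *v y) = A *v (D *v y)"
    by (simp add: matrix_vector_mul_assoc AD)
  also have "\<dots> = D *v (\<nu> *\<^sub>R y)"
    using x xy by (simp add: matrix_vector_mult_scaleR)
  finally have eq: "mat2 u 0 0 u' *v y = \<nu> *\<^sub>R y"
    using D by (metis inj_matrix_vector_mult injD)
  obtain a b where y: "y = vec2 a b" by (rule vec2_cases)
  have "a \<noteq> 0 \<or> b \<noteq> 0"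
    using x xy y by (metis matrix_vector_mult_0_right scaleR_vec2 mult_zero_left scaleR_zero_left)
  then show ?thesis using eq y by auto
qed

lemma trace_diagonalized:
  assumes AD: "A ** D = D ** mat2 u 0 0 u'" and D: "det D \<noteq> 0"
  shows "trace A = u + u'"
proof -
  obtain a b c d where A: "A = mat2 a b c d" by (rule mat2_cases)
  obtain p q r s where Dm: "D = mat2 p q r s" by (rule mat2_cases)
  have "a * p + b * r = p * u" "c * p + d * r = r * u" "a * q + b * s = q * u'" "c * q + d * s = s * u'"
    using AD by (simp_all add: A Dm)
  then have "(a + d) * (p * s - q * r) = (u + u') * (p * s - q * r)" by algebra
  then show ?thesis using D by (simp add: A Dm)
qed

lemma mat2_columns:
  assumes "A *v vec2 a c = u *\<^sub>R vec2 a c" "A *v vec2 b d = u' *\<^sub>R vec2 b d"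
  shows "A ** mat2 a b c d = mat2 a b c d ** mat2 u 0 0 u'"
  using assms by (cases A rule: mat2_cases) (simp add: mult.commute)

lemma trace_field_square: "(hecke_lambda q)^2 \<in> trace_field q"
  by (simp add: trace_field_def field_gen.gen)

lemma trace_field_of_nat: "of_nat n \<in> trace_field q"
  using field_gen.rat[of "of_nat n"] by (simp add: trace_field_def)

lemma trace_field_add: "x \<in> trace_field q \<Longrightarrow> y \<in> trace_field q \<Longrightarrow> x + y \<in> trace_field q"
  by (simp add: trace_field_def field_gen.add)

lemma trace_field_mult: "x \<in> trace_field q \<Longrightarrow> y \<in> trace_field q \<Longrightarrow> x * y \<in> trace_field q"
  by (simp add: trace_field_def field_gen.mult)

lemma trace_field_uminus: "x \<in> trace_field q \<Longrightarrow> - x \<in> trace_field q"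
  by (simp add: trace_field_def field_gen.uminus)

lemma trace_field_inverse: "x \<in> trace_field q \<Longrightarrow> inverse x \<in> trace_field q"
  by (simp add: trace_field_def field_gen.inverse)

lemma trace_field_diff: "x \<in> trace_field q \<Longrightarrow> y \<in> trace_field q \<Longrightarrow> x - y \<in> trace_field q"
  using trace_field_add[OF _ trace_field_uminus] by force

lemma trace_field_divide: "x \<in> trace_field q \<Longrightarrow> y \<in> trace_field q \<Longrightarrow> x / y \<in> trace_field q"
  using trace_field_mult[OF _ trace_field_inverse] by (force simp: divide_inverse)

lemma trace_field_1: "1 \<in> trace_field q"
  using trace_field_of_nat[of 1] by simp

lemma trace_field_numeral: "numeral n \<in> trace_field q"
  using trace_field_of_nat[of "numeral n"] by simp

lemma trace_field_power: "x \<in> trace_field q \<Longrightarrow> x ^ n \<in> trace_field q"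
  by (induction n) (simp_all add: trace_field_1 trace_field_mult)

lemmas trace_field_intros =
  trace_field_square trace_field_add trace_field_mult trace_field_uminus trace_field_inverse
  trace_field_diff trace_field_divide trace_field_1 trace_field_numeral trace_field_power

lemma hecke_lambda_ge_1: "q \<ge> 3 \<Longrightarrow> hecke_lambda q \<ge> 1"
proof -
  assume "q \<ge> 3"
  then have "cos (pi / 3) \<le> cos (pi / real q)"
    by (intro cos_monotone_0_pi_le) (auto simp: field_simps)
  then show ?thesis by (simp add: hecke_lambda_def cos_60)
qed

section \<open>A family of special hyperbolic elements\<close>

text \<open>The matrix \<open>(xij) diag(e, 1/e) (zij) diag(1/e, e)\<close>, with \<open>t = e^-2\<close>, has the eigenvectors
  \<open>(k, x21 z11 + x22 z21 t)\<close> and \<open>(x11 z12 + x12 z22 t, - k t)\<close>.\<close>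
lemma eigenvectors_of_twisted_product:
  fixes x11 x12 x21 x22 z11 z12 z21 z22 :: real
  assumes "x11 * z11 = k" "x22 * z22 = - k" "x12 * z21 = w^2" "x21 * z12 = v^2" "v * w = 1"
    and "x11 * x22 - x12 * x21 = 1" "z11 * z22 - z12 * z21 = 1" "e^2 * t = 1"
  shows
    "x11 * (z11 * k + z12 * (x21 * z11 + x22 * z21 * t) * e^2)
      + x12 * (z21 * k * t + z22 * (x21 * z11 + x22 * z21 * t)) = v^2 * e^2 * k" (is "?la = ?ra")
    "x21 * (z11 * k + z12 * (x21 * z11 + x22 * z21 * t) * e^2)
      + x22 * (z21 * k * t + z22 * (x21 * z11 + x22 * z21 * t))
      = v^2 * e^2 * (x21 * z11 + x22 * z21 * t)" (is "?lb = ?rb")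
    "x11 * (z11 * (x11 * z12 + x12 * z22 * t) + z12 * (- k * t) * e^2)
      + x12 * (z21 * (x11 * z12 + x12 * z22 * t) * t + z22 * (- k * t))
      = w^2 * t * (x11 * z12 + x12 * z22 * t)" (is "?lc = ?rc")
    "x21 * (z11 * (x11 * z12 + x12 * z22 * t) + z12 * (- k * t) * e^2)
      + x22 * (z21 * (x11 * z12 + x12 * z22 * t) * t + z22 * (- k * t)) = w^2 * t * (- k * t)" (is "?ld = ?rd")
proof -
  have "(x11 * x22) * (z11 * z22) = (x11 * z11) * (x22 * z22)" by (simp only: ac_simps)
  then have "k^2 = - ((x11 * x22) * (z11 * z22))"
    unfolding assms(1,2) by (simp add: power2_eq_square)
  also have "\<dots> = - ((1 + x12 * x21) * (1 + z12 * z21))"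
    using assms(6,7) by (simp add: algebra_simps)
  finally have k2: "k^2 = - ((1 + x12 * x21) * (1 + z12 * z21))" .
  have "(x12 * z21) * (x21 * z12) = (v * w)^2"
    unfolding assms(3,4) by (simp add: power_mult_distrib)
  then have "(x12 * x21) * (z12 * z21) = 1" using assms(5) by (simp add: ac_simps)
  moreover have "x11 * x22 = 1 + x12 * x21" "z11 * z22 = 1 + z12 * z21"
    using assms(6,7) by simp_all
  \<comment> \<open>Because \<open>e^2 * t = 1\<close>, exactly these three terms collect in the
    constant part of the first identity and in the coefficient of \<open>t\<close> in the last
    one.\<close>
  ultimately have 0: "k^2 + x11 * x22 * z12 * z21 + x12 * x21 * z11 * z22 = 0"
    using k2 by algebra
  have "?la = (x11 * z11) * k + (x11 * z11) * (x21 * z12) * e^2 + x11 * x22 * z12 * z21 * (e^2 * t)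
      + (x12 * z21) * k * t + x12 * x21 * z11 * z22 + (x12 * z21) * (x22 * z22) * t"
    by (simp add: algebra_simps)
  with 0 show "?la = ?ra"
    unfolding assms by (simp add: algebra_simps power2_eq_square)
  have "?lb = k * (x21 * z11 + x22 * z21 * t) + (x21 * z12) * (x21 * z11 + x22 * z21 * t) * e^2
      + (x22 * z22) * (x21 * z11 + x22 * z21 * t)"
    by (simp add: algebra_simps)
  then show "?lb = ?rb"
    unfolding assms by (simp add: algebra_simps)
  have "?lc = (x11 * z11) * (x11 * z12 + x12 * z22 * t) - k * x11 * z12 * (e^2 * t)
      + (x12 * z21) * t * (x11 * z12 + x12 * z22 * t) - k * x12 * z22 * t"
    by (simp add: algebra_simps)
  then show "?lc = ?rc"
    unfolding assms by (simp add: algebra_simps)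
  have "?ld = (x11 * z11) * (x21 * z12) + (x12 * x21 * z11 * z22) * t - k * (x21 * z12) * (e^2 * t)
      + (x11 * x22 * z12 * z21) * t + (x22 * z22) * (x12 * z21) * t^2 - (x22 * z22) * k * t"
    by (simp add: algebra_simps power2_eq_square)
  also have "\<dots> = (k^2 + x11 * x22 * z12 * z21 + x12 * x21 * z11 * z22) * t + w^2 * t * (- k * t)"
    unfolding assms by (simp add: algebra_simps power2_eq_square)
  finally show "?ld = ?rd" by (simp add: 0)
qed

text \<open>The arithmetic condition on \<open>q\<close>: \<open>4 * l^4 + 1\<close> has a square
  root in the trace field. Taking it positive makes \<open>v\<close> the larger of the two square
  roots \<open>v\<close> and \<open>w\<close> of the eigenvalues of \<open>Y\<close>.\<close>

locale hecke_square =
  fixes q :: nat and r :: real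
  assumes q3: "q \<ge> 3"
    and r_pos: "r > 0"
    and r_square: "r^2 = 4 * hecke_lambda q ^ 4 + 1"
    and r_trace_field: "r \<in> trace_field q"
begin

abbreviation l :: real where "l \<equiv> hecke_lambda q"
definition v :: real where "v = r + 2 * l^2"
definition w :: real where "w = r - 2 * l^2"

definition X :: mat2 where "X = mat2 (2 * l) 1 (- 1) 0"
definition Y :: mat2 where
  "Y = mat2 (16 * l^4 - 4 * l^2 + 1) (8 * l^3) (8 * l^3) (4 * l^2 + 1)"
definition Z :: mat2 where
  "Z = mat2 (4 * l^3) (4 * l^2 - 8 * l^4 - 1) (4 * l^2 + 1) (2 * l - 8 * l^3)"

lemma X_hecke: "X \<in> hecke_group q"
proof -
  have "X = sl2_inv (hecke_T q) ** (sl2_inv (hecke_T q) ** sl2_inv hecke_S)"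
    by (simp add: X_def hecke_T_def hecke_S_def)
  then show ?thesis by (simp add: hecke_group.intros)
qed

lemma Y_hecke: "Y \<in> hecke_group q"
proof -
  let ?T = "hecke_T q"
  define W where "W = ?T ** (?T ** (hecke_S ** (?T ** ?T)))"
  have W: "W \<in> hecke_group q" unfolding W_def by (simp add: hecke_group.intros)
  have "W = mat2 (2 * l) (4 * l^2 - 1) 1 (2 * l)"
    by (simp add: W_def hecke_T_def hecke_S_def power2_eq_square)
  \<comment> \<open>With \<open>P = T^2\<close> one has \<open>W = P S P\<close>, and
    \<open>S^-1 = - S\<close> turns this word into the commutator of \<open>P\<close> and
    \<open>S P S^-1\<close>.\<close>
  then have "Y = W ** (sl2_inv hecke_S ** (sl2_inv W ** hecke_S))"
    by (simp add: Y_def hecke_S_def algebra_simps power2_eq_square power3_eq_cube power4_eq_xxxx)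
  then show ?thesis using W by (simp add: hecke_group.intros)
qed

lemma Z_hecke: "Z \<in> hecke_group q"
proof -
  let ?T = "hecke_T q"
  define V where "V = sl2_inv hecke_S ** (sl2_inv ?T ** hecke_S)"
  have V: "V \<in> hecke_group q" unfolding V_def by (simp add: hecke_group.intros)
  have V': "V = mat2 1 0 l 1" by (simp add: V_def hecke_T_def hecke_S_def)
  have "Z = ?T ** (hecke_S ** (?T ** (?T ** (?T ** (?T **
      (V ** (sl2_inv hecke_S ** (V ** (hecke_S ** sl2_inv ?T)))))))))"
    by (simp add: Z_def V' hecke_T_def hecke_S_def algebra_simps
        power2_eq_square power3_eq_cube power4_eq_xxxx)
  then show ?thesis using V by (simp add: hecke_group.intros)
qed

lemma l_ge_1: "l \<ge> 1"
  by (rule hecke_lambda_ge_1[OF q3])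

lemma vw: "v * w = 1"
  using r_square unfolding v_def w_def by algebra

lemma v_gt_1: "v > 1"
proof -
  have "l^2 \<ge> 1" using l_ge_1 by simp
  then show ?thesis using r_pos by (simp add: v_def)
qed

lemma w_pos: "w > 0"
  using vw v_gt_1 by (metis less_trans zero_less_mult_pos zero_less_one)

lemma w_less_1: "w < 1"
  using mult_strict_right_mono[OF v_gt_1 w_pos] vw by simp

definition b1 :: "real^2" where "b1 = vec2 (2 * l) (r + 1 - 2 * l^2)"
definition b2 :: "real^2" where "b2 = vec2 (2 * l) (1 - 2 * l^2 - r)"

lemma Y_b1: "Y *v b1 = v^2 *\<^sub>R b1" and Y_b2: "Y *v b2 = w^2 *\<^sub>R b2"
  using r_square unfolding Y_def b1_def b2_def v_def w_def mat2_mult_vec2 scaleR_vec2 vec2_eq_iff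
  by (intro conjI; algebra)+

text \<open>The \<open>xij\<close> and \<open>zij\<close> are the entries of \<open>X\<close> and
  \<open>Z\<close> in the eigenbasis \<open>b1\<close>, \<open>b2\<close> of
  \<open>Y\<close>.\<close>

definition x11 where "x11 = l * (v - 1) / r"
definition x12 where "x12 = (w - 1) / (2 * l * r)"
definition x21 where "x21 = (1 + v) / (2 * l * r)"
definition x22 where "x22 = l * (1 + w) / r"
definition z11 where "z11 = l * (1 + w)"
definition z12 where "z12 = r * v * (v - 1) / (2 * l)"
definition z21 where "z21 = - (r * w * (1 + w) / (2 * l))"
definition z22 where "z22 = - (l * (v - 1))"

lemma X_b1: "X *v b1 = x11 *\<^sub>R b1 + x21 *\<^sub>R b2"
  and X_b2: "X *v b2 = x12 *\<^sub>R b1 + x22 *\<^sub>R b2"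
  and Z_b1: "Z *v b1 = z11 *\<^sub>R b1 + z21 *\<^sub>R b2"
  and Z_b2: "Z *v b2 = z12 *\<^sub>R b1 + z22 *\<^sub>R b2"
proof -
  have nz: "l \<noteq> 0" "r \<noteq> 0" using l_ge_1 r_pos by auto
  show "X *v b1 = x11 *\<^sub>R b1 + x21 *\<^sub>R b2"
    using nz unfolding X_def b1_def b2_def v_def w_def x11_def x21_def mat2_mult_vec2 scaleR_vec2 add_vec2 vec2_eq_iff
    by (intro conjI; simp add: field_simps; use r_square in algebra)
  show "X *v b2 = x12 *\<^sub>R b1 + x22 *\<^sub>R b2"
    using nz unfolding X_def b1_def b2_def v_def w_def x12_def x22_def mat2_mult_vec2 scaleR_vec2 add_vec2 vec2_eq_iff
    by (intro conjI; simp add: field_simps; use r_square in algebra)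
  show "Z *v b1 = z11 *\<^sub>R b1 + z21 *\<^sub>R b2"
    using nz unfolding Z_def b1_def b2_def v_def w_def z11_def z21_def mat2_mult_vec2 scaleR_vec2 add_vec2 vec2_eq_iff
    by (intro conjI; simp add: field_simps; use r_square in algebra)
  show "Z *v b2 = z12 *\<^sub>R b1 + z22 *\<^sub>R b2"
    using nz unfolding Z_def b1_def b2_def v_def w_def z12_def z22_def mat2_mult_vec2 scaleR_vec2 add_vec2 vec2_eq_iff
    by (intro conjI; simp add: field_simps; use r_square in algebra)
qed

text \<open>The reason for the choice of \<open>X\<close> and \<open>Z\<close>. In the trace of
  \<open>X Y^m Z Y^-m\<close> the first two products cancel, while the next two are inverse to each
  other by \<open>vw\<close> and get multiplied by inverse powers. The last two equations are the
  determinants.\<close>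

lemma xz:
  "x11 * z11 = 4 * l^4 / r" "x22 * z22 = - (4 * l^4 / r)" "x12 * z21 = w^2" "x21 * z12 = v^2"
  "x11 * x22 - x12 * x21 = 1" "z11 * z22 - z12 * z21 = 1"
proof -
  have nz: "l \<noteq> 0" "r \<noteq> 0" using l_ge_1 r_pos by auto
  show "x11 * z11 = 4 * l^4 / r" using nz r_square
    unfolding x11_def z11_def v_def w_def by (simp add: field_simps) algebra
  show "x22 * z22 = - (4 * l^4 / r)" using nz r_square
    unfolding x22_def z22_def v_def w_def by (simp add: field_simps) algebra
  show "x12 * z21 = w^2" using nz r_square
    unfolding x12_def z21_def v_def w_def by (simp add: field_simps) algebra
  show "x21 * z12 = v^2" using nz r_square
    unfolding x21_def z12_def v_def w_def by (simp add: field_simps) algebra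
  show "x11 * x22 - x12 * x21 = 1" using nz r_square
    unfolding x11_def x12_def x21_def x22_def v_def w_def by (simp add: field_simps) algebra
  show "z11 * z22 - z12 * z21 = 1" using nz r_square
    unfolding z11_def z12_def z21_def z22_def v_def w_def by (simp add: field_simps) algebra
qed

text \<open>\<open>M\<close> and \<open>M'\<close> are \<open>Y^m\<close> and \<open>Y^-m\<close>,
  described by their action on the eigenbasis.\<close>

lemma Y_powers:
  "\<exists>M \<in> hecke_group q. \<exists>M' \<in> hecke_group q.
     M *v b1 = v^(2*m) *\<^sub>R b1 \<and> M *v b2 = w^(2*m) *\<^sub>R b2 \<and>
     M' *v b1 = w^(2*m) *\<^sub>R b1 \<and> M' *v b2 = v^(2*m) *\<^sub>R b2"
proof (induction m)
  case 0
  then show ?case by (auto intro!: bexI[of _ "mat 1"] hecke_group_one)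
next
  case (Suc m)
  then obtain M M' where M: "M \<in> hecke_group q" "M' \<in> hecke_group q"
    "M *v b1 = v^(2*m) *\<^sub>R b1" "M *v b2 = w^(2*m) *\<^sub>R b2"
    "M' *v b1 = w^(2*m) *\<^sub>R b1" "M' *v b2 = v^(2*m) *\<^sub>R b2" by blast
  have inv: "sl2_inv Y *v b = d *\<^sub>R b" if "Y *v b = d' *\<^sub>R b" "d' * d = 1" for b d d'
  proof -
    have "d * d' = 1" using that(2) by (simp add: mult.commute)
    then have "sl2_inv Y *v b = d *\<^sub>R (sl2_inv Y *v (Y *v b))"
      by (simp add: that(1) matrix_vector_mult_scaleR)
    also have "\<dots> = d *\<^sub>R b"
      by (simp add: matrix_vector_mul_assoc sl2_inv_left det_hecke_group[OF Y_hecke])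
    finally show ?thesis .
  qed
  have vw2: "v^2 * w^2 = 1" "w^2 * v^2 = 1" using vw by (simp_all add: mult.commute flip: power_mult_distrib)
  have "(Y ** M) *v b1 = v^(2 * Suc m) *\<^sub>R b1" "(Y ** M) *v b2 = w^(2 * Suc m) *\<^sub>R b2"
    "(sl2_inv Y ** M') *v b1 = w^(2 * Suc m) *\<^sub>R b1" "(sl2_inv Y ** M') *v b2 = v^(2 * Suc m) *\<^sub>R b2"
    by (simp_all add: M(3-6) inv[OF Y_b1 vw2(1)] inv[OF Y_b2 vw2(2)] Y_b1 Y_b2
        matrix_vector_mult_scaleR power2_eq_square mult_ac flip: matrix_vector_mul_assoc)
  then show ?case
    using M(1,2) Y_hecke by (blast intro: hecke_group.intros)
qed

definition t :: "nat \<Rightarrow> real" where "t m = w ^ (4 * m)"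
text \<open>The columns \<open>(p1, p2)\<close> and \<open>(q1, q2)\<close> are the eigenvectors of
  the twisted product in standard coordinates, divided by factors independent of \<open>m\<close>.
  They converge as \<open>t m\<close> tends to 0.\<close>

definition p1 :: "nat \<Rightarrow> real" where "p1 m = (1 + w) * (v - w * t m)"
definition p2 :: "nat \<Rightarrow> real" where "p2 m = - 2 * l * (1 - w * t m)"
definition q1 :: "nat \<Rightarrow> real" where "q1 m = 2 * l * (v - w * t m)"
definition q2 :: "nat \<Rightarrow> real" where "q2 m = (v + 1) * (1 + w * t m)"
definition D :: "nat \<Rightarrow> mat2" where "D m = mat2 (p1 m) (q1 m) (p2 m) (q2 m)"
definition u :: "nat \<Rightarrow> real" where "u m = v ^ (4 * m + 2)"

lemma first_column:
  "(4 * l^4 / r) *\<^sub>R b1 + (x21 * z11 + x22 * z21 * t m) *\<^sub>R b2 = (l * (1 + w)) *\<^sub>R vec2 (p1 m) (p2 m)"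
proof -
  have nz: "l \<noteq> 0" "r \<noteq> 0" using l_ge_1 r_pos by auto
  show ?thesis
    using nz unfolding p1_def p2_def b1_def b2_def v_def w_def x21_def z11_def x22_def z21_def
      scaleR_vec2 add_vec2 vec2_eq_iff
    by (intro conjI; simp add: field_simps; use r_square in algebra)
qed

lemma second_column:
  "(x11 * z12 + x12 * z22 * t m) *\<^sub>R b1 + (- (4 * l^4 / r) * t m) *\<^sub>R b2
    = ((v - 1)^2 / 2) *\<^sub>R vec2 (q1 m) (q2 m)"
proof -
  have nz: "l \<noteq> 0" "r \<noteq> 0" using l_ge_1 r_pos by auto
  show ?thesis
    using nz unfolding q1_def q2_def b1_def b2_def v_def w_def x11_def z12_def x12_def z22_def
      scaleR_vec2 add_vec2 vec2_eq_iff
    by (intro conjI; simp add: field_simps; use r_square in algebra)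
qed

lemma diagonalizable_hecke_elements:
  "\<exists>A \<in> hecke_group q. A ** D m = D m ** mat2 (u m) 0 0 (inverse (u m))"
proof -
  obtain M M' where M: "M \<in> hecke_group q" "M' \<in> hecke_group q"
    and Mb: "M *v b1 = v^(2*m) *\<^sub>R b1" "M *v b2 = w^(2*m) *\<^sub>R b2"
    "M' *v b1 = w^(2*m) *\<^sub>R b1" "M' *v b2 = v^(2*m) *\<^sub>R b2" using Y_powers by blast
  \<comment> \<open>\<open>e\<close> and \<open>f\<close> are the eigenvalues of \<open>Y^m\<close>
    on \<open>b1\<close> and \<open>b2\<close>, so \<open>t m = f^2\<close> is the parameter
    \<open>t\<close> with \<open>e^2 * t = 1\<close> of
    \<open>eigenvectors_of_twisted_product\<close>.\<close>
  define e where "e = v^(2*m)"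
  define f where "f = w^(2*m)"
  have ef: "e * f = 1" using vw by (simp add: e_def f_def flip: power_mult_distrib)
  have tf: "t m = f^2" by (simp add: t_def f_def flip: power_mult)
  have et: "e^2 * t m = 1" using ef by (simp add: tf flip: power_mult_distrib)
  have "4 * m + 2 = 2 + 2 * m * 2" by simp
  then have u: "u m = v^2 * e^2" by (simp only: u_def e_def power_add power_mult)
  have iu: "inverse (u m) = w^2 * t m"
  proof (rule inverse_unique)
    have "u m * (w^2 * t m) = (v * w)^2 * (e^2 * t m)" unfolding u by (simp add: power_mult_distrib)
    then show "u m * (w^2 * t m) = 1" by (simp add: vw et)
  qed
  define A where "A = X ** (M ** (Z ** M'))"
  have A: "A \<in> hecke_group q"
    unfolding A_def using M X_hecke Z_hecke by (intro hecke_group.mult)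
  have Ab: "A *v (a *\<^sub>R b1 + b *\<^sub>R b2) =
      (x11 * (z11 * a + z12 * b * e^2) + x12 * (z21 * a * t m + z22 * b)) *\<^sub>R b1 +
      (x21 * (z11 * a + z12 * b * e^2) + x22 * (z21 * a * t m + z22 * b)) *\<^sub>R b2" for a b
  proof -
    have "M' *v (a *\<^sub>R b1 + b *\<^sub>R b2) = (a * f) *\<^sub>R b1 + (b * e) *\<^sub>R b2"
      by (simp add: Mb matrix_vector_right_distrib matrix_vector_mult_scaleR e_def f_def)
    moreover have "Z *v (c *\<^sub>R b1 + d *\<^sub>R b2) = (c * z11 + d * z12) *\<^sub>R b1 + (c * z21 + d * z22) *\<^sub>R b2" for c d
      by (simp add: Z_b1 Z_b2 matrix_vector_right_distrib matrix_vector_mult_scaleR algebra_simps)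
    moreover have "M *v (c *\<^sub>R b1 + d *\<^sub>R b2) = (c * e) *\<^sub>R b1 + (d * f) *\<^sub>R b2" for c d
      by (simp add: Mb matrix_vector_right_distrib matrix_vector_mult_scaleR e_def f_def)
    moreover have "X *v (c *\<^sub>R b1 + d *\<^sub>R b2) = (c * x11 + d * x12) *\<^sub>R b1 + (c * x21 + d * x22) *\<^sub>R b2" for c d
      by (simp add: X_b1 X_b2 matrix_vector_right_distrib matrix_vector_mult_scaleR algebra_simps)
    ultimately have "A *v (a *\<^sub>R b1 + b *\<^sub>R b2) =
      ((a * f * z11 + b * e * z12) * e * x11 + (a * f * z21 + b * e * z22) * f * x12) *\<^sub>R b1 +
      ((a * f * z11 + b * e * z12) * e * x21 + (a * f * z21 + b * e * z22) * f * x22) *\<^sub>R b2"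
      by (simp only: A_def flip: matrix_vector_mul_assoc)
    moreover have "(a * f * z11 + b * e * z12) * e = z11 * a + z12 * b * e^2"
      "(a * f * z21 + b * e * z22) * f = z21 * a * t m + z22 * b"
      using ef unfolding tf by algebra+
    ultimately show ?thesis by (simp only: mult.commute)
  qed
  note id = eigenvectors_of_twisted_product[OF xz(1-4) vw xz(5,6) et]
  have sc: "A *v vec2 y z = c *\<^sub>R vec2 y z"
    if "k \<noteq> 0" "A *v (k *\<^sub>R vec2 y z) = c *\<^sub>R (k *\<^sub>R vec2 y z)" for k c y z
  proof -
    have "k *\<^sub>R (A *v vec2 y z) = k *\<^sub>R (c *\<^sub>R vec2 y z)"
      using that(2) by (simp only: matrix_vector_mult_scaleR scaleR_scaleR mult.commute)
    with that(1) show ?thesis by (simp only: scaleR_cancel_left) simp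
  qed
  have "A *v vec2 (p1 m) (p2 m) = u m *\<^sub>R vec2 (p1 m) (p2 m)"
  proof (rule sc)
    show "l * (1 + w) \<noteq> 0" using l_ge_1 w_pos by auto
    show "A *v ((l * (1 + w)) *\<^sub>R vec2 (p1 m) (p2 m)) = u m *\<^sub>R ((l * (1 + w)) *\<^sub>R vec2 (p1 m) (p2 m))"
      unfolding first_column[symmetric] Ab id(1,2) u
      by (simp only: scaleR_add_right scaleR_scaleR)
  qed
  moreover have "A *v vec2 (q1 m) (q2 m) = inverse (u m) *\<^sub>R vec2 (q1 m) (q2 m)"
  proof (rule sc)
    show "(v - 1)^2 / 2 \<noteq> 0" using v_gt_1 by simp
    show "A *v (((v - 1)^2 / 2) *\<^sub>R vec2 (q1 m) (q2 m)) = inverse (u m) *\<^sub>R (((v - 1)^2 / 2) *\<^sub>R vec2 (q1 m) (q2 m))"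
      unfolding second_column[symmetric] Ab id(3,4) iu
      by (simp only: scaleR_add_right scaleR_scaleR)
  qed
  ultimately have "A ** D m = D m ** mat2 (u m) 0 0 (inverse (u m))"
    unfolding D_def by (rule mat2_columns)
  with A show ?thesis by blast
qed

lemma t_pos: "t m > 0" and t_le_1: "t m \<le> 1"
  using w_pos w_less_1 by (simp_all add: t_def power_le_one)

lemma wt: "0 < w * t m" "w * t m \<le> w" "w * t m < 1"
proof -
  show "0 < w * t m" using w_pos t_pos by simp
  show "w * t m \<le> w" using w_pos t_le_1[of m] by simp
  then show "w * t m < 1" using w_less_1 by linarith
qed

lemma det_D: "det (D m) \<ge> v - w"
proof -
  have "v - w * t m \<ge> v - w" using wt(2)[of m] by linarith
  moreover have "v - w \<ge> 0" using v_gt_1 w_less_1 by linarith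
  moreover have "(1 + w) * (v + 1) * (1 + w * t m) \<ge> 1 * 1 * 1"
    using w_pos v_gt_1 wt(1)[of m] by (intro mult_mono) auto
  moreover have "2 * l * (2 * l * (1 - w * t m)) \<ge> 0"
    using l_ge_1 wt(3)[of m] by (intro mult_nonneg_nonneg) auto
  \<comment> \<open>The determinant has the factor \<open>v - w * t m\<close>; the cofactor is at
    least 1 because its first summand is.\<close>
  ultimately have "(v - w) * 1 \<le> (v - w * t m) * ((1 + w) * (v + 1) * (1 + w * t m) + 2 * l * (2 * l * (1 - w * t m)))"
    by (intro mult_mono) auto
  also have "\<dots> = det (D m)"
    by (simp add: D_def p1_def p2_def q1_def q2_def algebra_simps)
  finally show ?thesis by simp
qed

lemma bound_D: "\<bar>D m$i$j\<bar> \<le> 2 * l * (2 * v)"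
proof -
  have lv: "2 * v \<le> 2 * l * (2 * v)" "2 * l * v \<le> 2 * l * (2 * v)" "2 * l \<le> 2 * l * (2 * v)"
    "(v + 1) * 2 \<le> 2 * l * (2 * v)"
  proof -
    have "v \<le> l * v" "l \<le> l * v" using l_ge_1 v_gt_1 by simp_all
    moreover have "2 * l * (2 * v) = 4 * (l * v)" "2 * l * v = 2 * (l * v)" "(v + 1) * 2 = 2 * v + 2"
      by (simp_all add: algebra_simps)
    ultimately show "2 * v \<le> 2 * l * (2 * v)" "2 * l * v \<le> 2 * l * (2 * v)"
      "2 * l \<le> 2 * l * (2 * v)" "(v + 1) * 2 \<le> 2 * l * (2 * v)"
      using l_ge_1 v_gt_1 by linarith+
  qed
  have d: "0 \<le> v - w * t m" "v - w * t m \<le> v" "0 \<le> 1 - w * t m" "1 - w * t m \<le> 1" "0 \<le> 1 + w * t m"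
    "1 + w * t m \<le> 2"
    using wt[of m] v_gt_1 by auto
  have "0 \<le> p1 m" "p1 m \<le> 2 * v"
    unfolding p1_def using d w_pos w_less_1 by (auto intro!: mult_mono)
  moreover have "0 \<le> - p2 m" "- p2 m \<le> 2 * l"
    unfolding p2_def using d l_ge_1 by (auto simp: mult_le_cancel_left1)
  moreover have "0 \<le> q1 m" "q1 m \<le> 2 * l * v"
    unfolding q1_def using d l_ge_1 by auto
  moreover have "0 \<le> q2 m" "q2 m \<le> (v + 1) * 2"
    unfolding q2_def using d v_gt_1 mult_left_mono[of "1 + w * t m" 2 "v + 1"] by auto
  ultimately show ?thesis
    using exhaust_2[of i] exhaust_2[of j] lv by (auto simp: D_def)
qed

lemma p2_neg: "p2 m < 0"
  using l_ge_1 wt(3)[of m] by (simp add: p2_def)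

text \<open>The slope is a fractional linear function of \<open>t m\<close>, nonconstant since
  \<open>v \<noteq> 1\<close>, and \<open>t\<close> is injective since
  \<open>0 < w < 1\<close>.\<close>

lemma slope_inj: "inj (\<lambda>m. p1 m / p2 m)"
proof (rule injI)
  fix m n
  assume "p1 m / p2 m = p1 n / p2 n"
  then have "p1 m * p2 n = p1 n * p2 m"
    using p2_neg[of m] p2_neg[of n] by (simp add: field_simps)
  then have "(2 * l * (1 + w)) * ((v - w * t m) * (1 - w * t n)) =
      (2 * l * (1 + w)) * ((v - w * t n) * (1 - w * t m))"
    unfolding p1_def p2_def by algebra
  moreover have "2 * l * (1 + w) \<noteq> 0" using l_ge_1 w_pos by auto
  ultimately have "(v - w * t m) * (1 - w * t n) = (v - w * t n) * (1 - w * t m)"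
    by (simp only: mult_cancel_left) simp
  then have "w * (v - 1) * (t m - t n) = 0" by algebra
  then have "t m = t n" using w_pos v_gt_1 by simp
  then show "m = n"
    using w_pos w_less_1 by (simp add: t_def power_inject_exp')
qed

lemma trace_field_v: "v \<in> trace_field q" and trace_field_w: "w \<in> trace_field q"
  unfolding v_def w_def by (intro trace_field_intros r_trace_field)+

text \<open>The only factor outside the trace field is the \<open>l\<close> in the denominator, and
  \<open>1 / l = l / l^2\<close>.\<close>

lemma slope_in_field: "p1 m / p2 m \<in> (\<lambda>y. l * y) ` trace_field q"
proof
  show "p1 m / p2 m = l * ((1 + w) * (v - w * t m) / (- 2 * l^2 * (1 - w * t m)))"
    using l_ge_1 by (simp add: p1_def p2_def power2_eq_square)
  show "(1 + w) * (v - w * t m) / (- 2 * l^2 * (1 - w * t m)) \<in> trace_field q"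
    unfolding t_def by (intro trace_field_intros trace_field_v trace_field_w)
qed

lemma u_gt_1: "u m > 1"
  unfolding u_def using v_gt_1 by (intro one_less_power) auto

lemma special_slope:
  assumes "A \<in> hecke_group q" and AD: "A ** D m = D m ** mat2 (u m) 0 0 (inverse (u m))"
  shows "special_fixed_point q (Some (p1 m / p2 m))"
proof -
  have det: "det (D m) \<noteq> 0" using det_D[of m] v_gt_1 w_less_1 by linarith
  have uK: "u m \<in> trace_field q"
    unfolding u_def by (intro trace_field_intros trace_field_v)
  have "u m + inverse (u m) > 2"
  proof -
    have "(u m - 1)^2 > 0" using u_gt_1[of m] by simp
    then show ?thesis using u_gt_1[of m] by (simp add: field_simps power2_eq_square)
  qed
  then have "hyperbolic A"
    unfolding hyperbolic_def trace_diagonalized[OF AD det] by linarith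
  moreover have "\<mu> \<in> trace_field q" if "is_eigenvalue A \<mu>" for \<mu>
    using is_eigenvalue_diagonalized[OF AD _ that] det uK trace_field_inverse[OF uK]
    by (auto simp: invertible_det_nz)
  ultimately have "special q A" using assms(1) by (simp add: special_def)
  moreover have "mobius A (Some (p1 m / p2 m)) = Some (p1 m / p2 m)"
  proof (rule mobius_SomeI)
    obtain a b c d where A: "A = mat2 a b c d" by (rule mat2_cases)
    have "a * p1 m + b * p2 m = p1 m * u m" "c * p1 m + d * p2 m = p2 m * u m"
      using AD by (simp_all add: A D_def)
    then show "A *v vec2 (p1 m / p2 m) 1 = u m *\<^sub>R vec2 (p1 m / p2 m) 1"
      using p2_neg[of m] by (simp add: A field_simps)
    show "u m \<noteq> 0" using u_gt_1[of m] by simp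
  qed
  ultimately show ?thesis unfolding special_fixed_point_def by blast
qed

theorem infinite_orbits_of_special_fixed_points:
  "infinite {orbit q (Some x) | x. x \<in> (\<lambda>y. l * y) ` trace_field q \<and> special_fixed_point q (Some x)}"
    (is "infinite ?O")
proof
  assume fin: "finite ?O"
  define x where "x m = p1 m / p2 m" for m
  have "\<forall>m. \<exists>A. A \<in> hecke_group q \<and> A ** D m = D m ** mat2 (u m) 0 0 (inverse (u m))"
    using diagonalizable_hecke_elements by blast
  then obtain A where A: "\<And>m. A m \<in> hecke_group q"
      "\<And>m. A m ** D m = D m ** mat2 (u m) 0 0 (inverse (u m))" by metis
  have "(\<lambda>m. orbit q (Some (x m))) ` UNIV \<subseteq> ?O"
    using slope_in_field special_slope[OF A] by (auto simp: x_def)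
  then have "finite ((\<lambda>m. orbit q (Some (x m))) ` UNIV)" using fin by (rule finite_subset)
  \<comment> \<open>With finitely many orbits, one of them would contain the fixed points for
    infinitely many \<open>m\<close>, against \<open>finite_equivalent_axes\<close>.\<close>
  then obtain n where n: "infinite {m \<in> UNIV. orbit q (Some (x m)) = orbit q (Some (x n))}"
    using pigeonhole_infinite[OF infinite_UNIV_nat] by blast
  have "finite {m. Some (x m) \<in> orbit q (Some (x n))}"
    unfolding x_def
  proof (rule finite_equivalent_axes[where A = A and u = u and ?q1.0 = q1 and ?q2.0 = q2
        and K = "2 * l * (2 * v)" and \<delta> = "v - w"])
    show "q \<ge> 2" using q3 by simp
    show "v - w > 0" using v_gt_1 w_less_1 by simp
    show "p2 m \<noteq> 0" for m using p2_neg[of m] by simp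
  qed (rule A u_gt_1 slope_inj A(2)[unfolded D_def] bound_D[unfolded D_def] det_D[unfolded D_def])+
  moreover have "{m \<in> UNIV. orbit q (Some (x m)) = orbit q (Some (x n))} \<subseteq>
      {m. Some (x m) \<in> orbit q (Some (x n))}"
    using orbit_refl by blast
  ultimately show False using n finite_subset by blast
qed

end

section \<open>The case q = 18\<close>

lemma hecke_lambda_18_minpoly:
  "hecke_lambda 18 ^ 6 - 6 * hecke_lambda 18 ^ 4 + 9 * hecke_lambda 18 ^ 2 - 3 = 0"
proof -
  define c where "c = cos (pi / 18)"
  \<comment> \<open>Tripling the angle gives \<open>l^3 - 3 * l = 2 * cos (pi / 6) = sqrt 3\<close>;
    squaring yields the equation.\<close>
  have "cos (3 * (pi / 18)) = 4 * c^3 - 3 * c"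
    unfolding c_def by (rule cos_treble_cos)
  then have "4 * c^3 - 3 * c = sqrt 3 / 2" by (simp add: cos_30)
  moreover have "hecke_lambda 18 ^ 3 - 3 * hecke_lambda 18 = 2 * (4 * c^3 - 3 * c)"
    by (simp add: hecke_lambda_def c_def algebra_simps power3_eq_cube)
  ultimately have "(hecke_lambda 18 ^ 3 - 3 * hecke_lambda 18)^2 = 3" by simp
  moreover have "hecke_lambda 18 ^ 6 - 6 * hecke_lambda 18 ^ 4 + 9 * hecke_lambda 18 ^ 2 - 3
      = (hecke_lambda 18 ^ 3 - 3 * hecke_lambda 18)^2 - 3"
    by (simp add: eval_nat_numeral algebra_simps)
  ultimately show ?thesis by (simp only:)
qed

theorem theorem1p1:
  shows "infinite {orbit 18 (Some x) | x.
            x \<in> (\<lambda>y. hecke_lambda 18 * y) ` trace_field 18 \<and>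
            special_fixed_point 18 (Some x)}"
proof -
  define l where "l = hecke_lambda 18"
  define r where "r = 2 * l^4 - 6 * l^2 + 1"
  have min: "l^6 - 6 * l^4 + 9 * l^2 - 3 = 0"
    unfolding l_def by (rule hecke_lambda_18_minpoly)
  \<comment> \<open>Needed for the sign of the root, as
    \<open>r = 2 * l^2 * (l^2 - 3) + 1\<close>.\<close>
  have "l^2 \<ge> 3"
  proof -
    have "cos (pi / 6) \<le> cos (pi / 18)" by (intro cos_monotone_0_pi_le) auto
    then have "sqrt 3 \<le> l" by (simp add: cos_30 l_def hecke_lambda_def)
    then show ?thesis by (simp add: real_le_rsqrt sqrt_le_D)
  qed
  then have "l^2 * (l^2 - 3) \<ge> 0" by simp
  then have "r > 0" by (simp add: r_def algebra_simps flip: power_add)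
  \<comment> \<open>The difference of the two sides is \<open>4 * l^2\<close> times the polynomial
    in \<open>min\<close>.\<close>
  moreover have "r^2 = 4 * l^4 + 1" using min unfolding r_def by algebra
  moreover have "r \<in> trace_field 18"
  proof -
    have "r = 2 * (l^2 * l^2) - 6 * l^2 + 1" by (simp add: r_def flip: power_add)
    then show ?thesis unfolding l_def by (simp only:) (intro trace_field_intros)
  qed
  ultimately interpret hecke_square 18 r
    by unfold_locales (simp_all add: l_def)
  show ?thesis by (rule infinite_orbits_of_special_fixed_points)
qed

end
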